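(* Let $S$ be a monoid and let $\mathcal{X}$ be a class of $S$-acts closed under coproducts, direct summands and retracts. Let $\mathcal{U}_{\mathcal{X}}$ be the class of unitary $S$-monomorphisms $f:X\to Y$ such that $Y\setminus\operatorname{im}(f)\in\mathcal{X}$, and let $\mathcal{R}_{\mathcal{X}}$ be the class of all $S$-maps with respect to which each $S$-act in $\mathcal{X}$ is projective. Then every $S$-act has an $\mathcal{X}$-precover if and only if $(\mathcal{U}_{\mathcal{X}},\mathcal{R}_{\mathcal{X}})$ is a weak factorization system and for all $S$-acts $X$ there exists $Y\in\mathcal{X}$ such that $\hom(Y,X)\neq\emptyset$.
   Context: All acts are right $S$-acts and $S$-maps are the maps commuting with the action of $S$. Coproducts of $S$-acts are disjoint unions; a subact $B$ of $A$ is a direct summand of $A$ if $A=B\,\dot\cup\,Z$ for some $S$-act $Z$. $B$ is a retract of $A$ if there are $S$-maps $\alpha:B\to A$, $\beta:A\to B$ with $\beta\alpha=1_B$. A monomorphism $f:X\to Y$ is unitary if for all $y\in Y$, $s\in S$, $ys\in\operatorname{im}(f)$ implies $y\in\operatorname{im}(f)$. An $S$-act $P$ is projective with respect to an $S$-map $f:A\to B$ if for every $S$-map $g:P\to B$ there is an $S$-map $h:P\to A$ with $fh=g$. An $\mathcal{X}$-precover of an $S$-act $A$ is an $S$-map $g:P\to A$ with $P\in\mathcal{X}$ such that for every $S$-map $g':P'\to A$ with $P'\in\mathcal{X}$ there is an $S$-map $f:P'\to P$ with $g'=gf$. Given $S$-maps $f:A\to B$ and $g:C\to D$, $f$ has the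 left lifting property with respect to $g$ (equivalently $g$ has the right lifting property with respect to $f$) if for all $S$-maps $u:A\to C$, $v:B\to D$ with $gu=vf$ there is an $S$-map $h:B\to C$ with $hf=u$ and $gh=v$. For a class $\mathcal{C}$ of $S$-maps, $\mathcal{C}^\Box$ is the class of $S$-maps having the right lifting property with respect to every member of $\mathcal{C}$, and ${}^\Box\mathcal{C}$ is the class of $S$-maps having the left lifting property with respect to every member of $\mathcal{C}$. A weak factorization system $(\mathcal{L},\mathcal{R})$ consists of two classes of $S$-maps such that (1) $\mathcal{R}=\mathcal{L}^\Box$ and $\mathcal{L}={}^\Box\mathcal{R}$; (2) every $S$-map $h$ has a factorization $h=gf$ with $f\in\mathcal{L}$ and $g\in\mathcal{R}$. *)

theory Defs
  imports Main "HOL-Library.Disjoint_Sets"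
begin

text \<open>
  A class of acts is a set of acts over one fixed type \<open>'u\<close>, which plays the role of the class of
  all sets; \<open>small\<close> singles out those subsets of \<open>'u\<close> which count as sets.
  The assumptions are what is needed to form images and disjoint unions of set-indexed families
  inside \<open>'u\<close>. Both the proper-class reading (\<open>'u\<close> a type of ZF sets or a Grothendieck universe)
  and the reading "acts carried by arbitrary subsets of an infinite type" are instances.
\<close>

locale set_universe =
  fixes small :: "'u set \<Rightarrow> bool"
  assumes small_subset: "small A \<Longrightarrow> B \<subseteq> A \<Longrightarrow> small B"
    and small_image: "small A \<Longrightarrow> small (f ` A)"
    and small_pair: "\<exists>a b. a \<noteq> b \<and> small {a, b}"
    and small_disjoint_union:
      "small I \<Longrightarrow> (\<And>i. i \<in> I \<Longrightarrow> small (F i)) \<Longrightarrow>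
        \<exists>e :: 'u \<times> 'u \<Rightarrow> 'u. inj_on e (SIGMA i:I. F i) \<and> small (e ` (SIGMA i:I. F i))"

lemma set_universe_infinite_type:
  assumes "infinite (UNIV :: 'u set)"
  shows "set_universe (\<lambda>A :: 'u set. True)"
proof
  have "(card_of (UNIV \<times> UNIV :: ('u \<times> 'u) set), card_of (UNIV :: 'u set)) \<in> ordLeq"
    using card_of_Times_same_infinite[OF assms] ordIso_imp_ordLeq by blast
  then obtain e :: "'u \<times> 'u \<Rightarrow> 'u" where "inj e"
    by (auto simp: card_of_ordLeq[symmetric])
  then show "\<exists>e :: 'u \<times> 'u \<Rightarrow> 'u. inj_on e (SIGMA i:I. F i) \<and> True" for I F
    using inj_on_subset by blast
  obtain a :: 'u where True by blast
  have "\<exists>b. b \<noteq> a"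
    using assms by (metis UNIV_eq_I finite.simps insertI1)
  then show "\<exists>a b :: 'u. a \<noteq> b \<and> True" by blast
qed simp_all


section \<open>Acts and maps\<close>

record ('u, 's) act =
  points :: "'u set"
  action :: "'u \<Rightarrow> 's \<Rightarrow> 'u"

text \<open>The empty act is admitted: \<open>Y \ im f\<close> is empty for an isomorphism \<open>f\<close>.\<close>

definition is_act :: "('u set \<Rightarrow> bool) \<Rightarrow> ('u, 's::monoid_mult) act \<Rightarrow> bool" where
  "is_act small A \<longleftrightarrow> small (points A) \<and>
     (\<forall>x\<in>points A. \<forall>s. action A x s \<in> points A) \<and>
     (\<forall>x\<in>points A. action A x 1 = x) \<and>
     (\<forall>x\<in>points A. \<forall>s t. action A (action A x s) t = action A x (s * t))"

text \<open>Functions are relevant only on the points of their domain, as in HOL-Algebra; equations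
  between maps are therefore stated pointwise.\<close>

definition act_hom :: "('u, 's) act \<Rightarrow> ('u, 's) act \<Rightarrow> ('u \<Rightarrow> 'u) set" where
  "act_hom A B = {f. (\<forall>x\<in>points A. f x \<in> points B) \<and>
     (\<forall>x\<in>points A. \<forall>s. f (action A x s) = action B (f x) s)}"

record ('u, 's) act_map =
  Dom :: "('u, 's) act"
  Cod :: "('u, 's) act"
  app :: "'u \<Rightarrow> 'u"

definition is_map :: "('u set \<Rightarrow> bool) \<Rightarrow> ('u, 's::monoid_mult) act_map \<Rightarrow> bool" where
  "is_map small f \<longleftrightarrow> is_act small (Dom f) \<and> is_act small (Cod f) \<and> app f \<in> act_hom (Dom f) (Cod f)"

definition im :: "('u, 's) act_map \<Rightarrow> 'u set" where
  "im f = app f ` points (Dom f)"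


section \<open>Closure properties\<close>

definition is_coproduct ::
    "'i set \<Rightarrow> ('i \<Rightarrow> ('u, 's) act) \<Rightarrow> ('u, 's) act \<Rightarrow> bool" where
  "is_coproduct I F A \<longleftrightarrow>
     (\<exists>\<iota>. (\<forall>i\<in>I. \<iota> i \<in> act_hom (F i) A \<and> inj_on (\<iota> i) (points (F i))) \<and>
          disjoint_family_on (\<lambda>i. \<iota> i ` points (F i)) I \<and>
          points A = (\<Union>i\<in>I. \<iota> i ` points (F i)))"

definition subact :: "('u set \<Rightarrow> bool) \<Rightarrow> ('u, 's::monoid_mult) act \<Rightarrow> ('u, 's) act \<Rightarrow> bool" where
  "subact small B A \<longleftrightarrow> is_act small B \<and> points B \<subseteq> points A \<and>
     (\<forall>x\<in>points B. \<forall>s. action B x s = action A x s)"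

definition direct_summand ::
    "('u set \<Rightarrow> bool) \<Rightarrow> ('u, 's::monoid_mult) act \<Rightarrow> ('u, 's) act \<Rightarrow> bool" where
  "direct_summand small B A \<longleftrightarrow> subact small B A \<and>
     (\<exists>Z. subact small Z A \<and> points A = points B \<union> points Z \<and> points B \<inter> points Z = {})"

definition retract_of :: "('u, 's) act \<Rightarrow> ('u, 's) act \<Rightarrow> bool" where
  "retract_of B A \<longleftrightarrow> (\<exists>\<alpha>\<in>act_hom B A. \<exists>\<beta>\<in>act_hom A B. \<forall>x\<in>points B. \<beta> (\<alpha> x) = x)"

definition closed_under_coproducts ::
    "('u set \<Rightarrow> bool) \<Rightarrow> ('u, 's::monoid_mult) act set \<Rightarrow> bool" where
  "closed_under_coproducts small \<X> \<longleftrightarrow>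
     (\<forall>(I :: 'u set) F A. small I \<longrightarrow> (\<forall>i\<in>I. F i \<in> \<X>) \<longrightarrow> is_act small A \<longrightarrow>
        is_coproduct I F A \<longrightarrow> A \<in> \<X>)"

definition closed_under_direct_summands ::
    "('u set \<Rightarrow> bool) \<Rightarrow> ('u, 's::monoid_mult) act set \<Rightarrow> bool" where
  "closed_under_direct_summands small \<X> \<longleftrightarrow>
     (\<forall>A\<in>\<X>. \<forall>B. direct_summand small B A \<longrightarrow> B \<in> \<X>)"

definition closed_under_retracts ::
    "('u set \<Rightarrow> bool) \<Rightarrow> ('u, 's::monoid_mult) act set \<Rightarrow> bool" where
  "closed_under_retracts small \<X> \<longleftrightarrow>
     (\<forall>A\<in>\<X>. \<forall>B. is_act small B \<longrightarrow> retract_of B A \<longrightarrow> B \<in> \<X>)"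


section \<open>Precovers\<close>

definition projective_wrt :: "('u, 's) act \<Rightarrow> ('u, 's) act_map \<Rightarrow> bool" where
  "projective_wrt P f \<longleftrightarrow>
     (\<forall>g\<in>act_hom P (Cod f). \<exists>h\<in>act_hom P (Dom f). \<forall>x\<in>points P. app f (h x) = g x)"

definition is_precover ::
    "('u set \<Rightarrow> bool) \<Rightarrow> ('u, 's::monoid_mult) act set \<Rightarrow> ('u, 's) act \<Rightarrow> ('u, 's) act_map \<Rightarrow> bool"
  where
  "is_precover small \<X> A g \<longleftrightarrow> is_map small g \<and> Cod g = A \<and> Dom g \<in> \<X> \<and>
     (\<forall>P'\<in>\<X>. \<forall>g'\<in>act_hom P' A. \<exists>f\<in>act_hom P' (Dom g). \<forall>x\<in>points P'. g' x = app g (f x))"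


section \<open>Weak factorization systems\<close>

definition has_lifting :: "('u, 's) act_map \<Rightarrow> ('u, 's) act_map \<Rightarrow> bool" where
  "has_lifting f g \<longleftrightarrow>
     (\<forall>u\<in>act_hom (Dom f) (Dom g). \<forall>v\<in>act_hom (Cod f) (Cod g).
        (\<forall>x\<in>points (Dom f). app g (u x) = v (app f x)) \<longrightarrow>
        (\<exists>h\<in>act_hom (Cod f) (Dom g).
           (\<forall>x\<in>points (Dom f). h (app f x) = u x) \<and>
           (\<forall>y\<in>points (Cod f). app g (h y) = v y)))"

definition right_box ::
    "('u set \<Rightarrow> bool) \<Rightarrow> ('u, 's::monoid_mult) act_map set \<Rightarrow> ('u, 's) act_map set" where
  "right_box small \<C> = {g. is_map small g \<and> (\<forall>f\<in>\<C>. has_lifting f g)}"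

definition left_box ::
    "('u set \<Rightarrow> bool) \<Rightarrow> ('u, 's::monoid_mult) act_map set \<Rightarrow> ('u, 's) act_map set" where
  "left_box small \<C> = {f. is_map small f \<and> (\<forall>g\<in>\<C>. has_lifting f g)}"

definition factors_as :: "('u, 's) act_map \<Rightarrow> ('u, 's) act_map \<Rightarrow> ('u, 's) act_map \<Rightarrow> bool" where
  "factors_as h g f \<longleftrightarrow> Dom f = Dom h \<and> Cod f = Dom g \<and> Cod g = Cod h \<and>
     (\<forall>x\<in>points (Dom h). app h x = app g (app f x))"

definition weak_factorization_system ::
    "('u set \<Rightarrow> bool) \<Rightarrow> ('u, 's::monoid_mult) act_map set \<Rightarrow> ('u, 's) act_map set \<Rightarrow> bool" where
  "weak_factorization_system small \<L> \<R> \<longleftrightarrow>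
     \<R> = right_box small \<L> \<and> \<L> = left_box small \<R> \<and>
     (\<forall>h. is_map small h \<longrightarrow> (\<exists>f\<in>\<L>. \<exists>g\<in>\<R>. factors_as h g f))"


section \<open>The two classes of maps attached to a class of acts\<close>

definition unitary_mono :: "('u set \<Rightarrow> bool) \<Rightarrow> ('u, 's::monoid_mult) act_map \<Rightarrow> bool" where
  "unitary_mono small f \<longleftrightarrow> is_map small f \<and> inj_on (app f) (points (Dom f)) \<and>
     (\<forall>y\<in>points (Cod f). \<forall>s. action (Cod f) y s \<in> im f \<longrightarrow> y \<in> im f)"

definition unitary_class ::
    "('u set \<Rightarrow> bool) \<Rightarrow> ('u, 's::monoid_mult) act set \<Rightarrow> ('u, 's) act_map set" where
  "unitary_class small \<X> =
     {f. unitary_mono small f \<and> (Cod f)\<lparr>points := points (Cod f) - im f\<rparr> \<in> \<X>}"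

definition projecting_class ::
    "('u set \<Rightarrow> bool) \<Rightarrow> ('u, 's::monoid_mult) act set \<Rightarrow> ('u, 's) act_map set" where
  "projecting_class small \<X> = {f. is_map small f \<and> (\<forall>P\<in>\<X>. projective_wrt P f)}"

end

theory Submission
  imports Defs
begin

text \<open>
  A unitary monomorphism with complement in \<open>\<X>\<close> is, up to isomorphism, a coproduct inclusion
  \<open>A \<rightarrow> A \<squnion> Z\<close> with \<open>Z \<in> \<X>\<close>, so lifting against it amounts to lifting maps out of \<open>Z\<close>. Given
  precovers, a map \<open>f : A \<rightarrow> B\<close> factors as \<open>A \<rightarrow> A \<squnion> P \<rightarrow> B\<close>, where \<open>p : P \<rightarrow> B\<close> is a precover. If
  \<open>f\<close> lifts against \<open>A \<squnion> P \<rightarrow> B\<close>, then the lift exhibits \<open>B - im f\<close> as a retract of the direct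
  summand \<open>p\<^sup>-\<^sup>1 (B - im f)\<close> of \<open>P\<close>. Conversely, factoring \<open>\<emptyset> \<rightarrow> A\<close> yields a precover of \<open>A\<close>.
\<close>

section \<open>Acts and binary coproducts\<close>

lemma act_homI:
  assumes "\<And>x. x \<in> points A \<Longrightarrow> f x \<in> points B"
    and "\<And>x s. x \<in> points A \<Longrightarrow> f (action A x s) = action B (f x) s"
  shows "f \<in> act_hom A B"
  using assms by (auto simp: act_hom_def)

lemma act_hom_in: "f \<in> act_hom A B \<Longrightarrow> x \<in> points A \<Longrightarrow> f x \<in> points B"
  by (auto simp: act_hom_def)

lemma act_hom_action:
  "f \<in> act_hom A B \<Longrightarrow> x \<in> points A \<Longrightarrow> f (action A x s) = action B (f x) s"
  by (auto simp: act_hom_def)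

lemma act_hom_id: "(\<lambda>x. x) \<in> act_hom A A"
  by (auto simp: act_hom_def)

lemma act_hom_comp: "f \<in> act_hom A B \<Longrightarrow> g \<in> act_hom B C \<Longrightarrow> (\<lambda>x. g (f x)) \<in> act_hom A C"
  by (auto simp: act_hom_def)

lemma act_hom_restrict: "f \<in> act_hom A B \<Longrightarrow> C \<subseteq> points A \<Longrightarrow> f \<in> act_hom (A\<lparr>points := C\<rparr>) B"
  by (auto simp: act_hom_def)

lemma is_act_action: "is_act small A \<Longrightarrow> x \<in> points A \<Longrightarrow> action A x s \<in> points A"
  by (auto simp: is_act_def)

lemma (in set_universe) is_act_restrict:
  assumes "is_act small A" "B \<subseteq> points A" "\<And>x s. x \<in> B \<Longrightarrow> action A x s \<in> B"
  shows "is_act small (A\<lparr>points := B\<rparr>)"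
proof -
  have "small B"
    using assms(1,2) small_subset by (auto simp: is_act_def)
  with assms show ?thesis
    by (auto simp: is_act_def)
qed

text \<open>The inverse of a bijective \<open>S\<close>-map is again an \<open>S\<close>-map, so
  \<open>B\<close> is a retract of \<open>A\<close>. Thus closure under retracts includes closure
  under isomorphism, which is needed because coproducts contain only isomorphic copies of their
  summands.\<close>

lemma closed_under_retracts_iso:
  assumes "closed_under_retracts small \<X>" "A \<in> \<X>" "is_act small B"
    and f: "f \<in> act_hom A B" and bij: "bij_betw f (points A) (points B)" and A: "is_act small A"
  shows "B \<in> \<X>"
proof -
  define g where "g = inv_into (points A) f"
  have g: "g y \<in> points A" "f (g y) = y" if "y \<in> points B" for y
    using that bij by (auto simp: g_def bij_betw_def inv_into_into f_inv_into_f)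
  have gf: "g (f x) = x" if "x \<in> points A" for x
    using that bij by (auto simp: g_def bij_betw_def)
  have "g (action B y s) = action A (g y) s" if y: "y \<in> points B" for y s
  proof -
    have "action B y s = f (action A (g y) s)"
      using act_hom_action[OF f g(1)[OF y]] g(2)[OF y] by simp
    then show ?thesis
      using gf is_act_action[OF A g(1)[OF y]] by simp
  qed
  then have "g \<in> act_hom B A"
    using g by (intro act_homI)
  then have "retract_of B A"
    unfolding retract_of_def using f g by blast
  then show ?thesis
    using assms by (auto simp: closed_under_retracts_def)
qed

text \<open>Unlike in \<open>is_coproduct\<close>, the injections are arguments: copairings and
  lifts are specified by their values on the two summands, so the injections must be named.\<close>

definition binary_coproduct ::
    "('u, 's) act \<Rightarrow> ('u, 's) act \<Rightarrow> ('u, 's) act \<Rightarrow> ('u \<Rightarrow> 'u) \<Rightarrow> ('u \<Rightarrow> 'u) \<Rightarrow> bool" where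
  "binary_coproduct A P Q i j \<longleftrightarrow>
     i \<in> act_hom A Q \<and> j \<in> act_hom P Q \<and> inj_on i (points A) \<and> inj_on j (points P) \<and>
     i ` points A \<inter> j ` points P = {} \<and> points Q = i ` points A \<union> j ` points P"

text \<open>The existence half of the universal property. Every point of \<open>Q\<close> comes from
  exactly one summand, and acting on it stays in that summand, so equivariance is inherited from
  \<open>f\<close> and \<open>p\<close>.\<close>

lemma binary_coproduct_copair:
  assumes Q: "binary_coproduct A P Q i j" and A: "is_act small A" and P: "is_act small P"
    and f: "f \<in> act_hom A B" and p: "p \<in> act_hom P B"
  obtains g where "g \<in> act_hom Q B" "\<And>x. x \<in> points A \<Longrightarrow> g (i x) = f x"
    "\<And>x. x \<in> points P \<Longrightarrow> g (j x) = p x"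
proof -
  define g where "g = (\<lambda>q. if q \<in> i ` points A then f (inv_into (points A) i q)
    else p (inv_into (points P) j q))"
  have gi: "g (i x) = f x" if "x \<in> points A" for x
    using that Q by (auto simp: g_def binary_coproduct_def)
  have gj: "g (j x) = p x" if "x \<in> points P" for x
  proof -
    have "j x \<notin> i ` points A"
      using that Q by (auto simp: binary_coproduct_def)
    then show ?thesis
      using that Q by (auto simp: g_def binary_coproduct_def)
  qed
  have i: "i \<in> act_hom A Q" and j: "j \<in> act_hom P Q"
    using Q by (auto simp: binary_coproduct_def)
  have "g q \<in> points B \<and> g (action Q q s) = action B (g q) s" if q: "q \<in> points Q" for q s
  proof -
    consider x where "x \<in> points A" "q = i x" | x where "x \<in> points P" "q = j x"
      using q Q by (auto simp: binary_coproduct_def)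
    then show ?thesis
    proof cases
      case 1
      then show ?thesis
        using gi is_act_action[OF A] act_hom_action[OF i, symmetric] act_hom_action[OF f]
          act_hom_in[OF f] by simp
    next
      case 2
      then show ?thesis
        using gj is_act_action[OF P] act_hom_action[OF j, symmetric] act_hom_action[OF p]
          act_hom_in[OF p] by simp
    qed
  qed
  then have "g \<in> act_hom Q B"
    by (intro act_homI) auto
  with gi gj show thesis
    using that by blast
qed

text \<open>The disjoint union is indexed by two distinct elements \<open>a\<close> and
  \<open>b\<close> of the universe and encoded back into \<open>'u\<close> by an injection
  \<open>e\<close>; the action is transported along \<open>e\<close>.\<close>

lemma (in set_universe) binary_coproduct_exists:
  fixes A P :: "('u, 's::monoid_mult) act"
  assumes A: "is_act small A" and P: "is_act small P"
  obtains Q i j where "is_act small Q" "binary_coproduct A P Q i j"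
proof -
  obtain a b :: 'u where ab: "a \<noteq> b" "small {a, b}"
    using small_pair by blast
  define F where "F = (\<lambda>k. if k = a then A else P)"
  define S where "S = (SIGMA k:{a, b}. points (F k))"
  have F: "is_act small (F k)" for k
    using A P by (simp add: F_def)
  then obtain e where e: "inj_on e S" "small (e ` S)"
    using small_disjoint_union[of "{a, b}" "\<lambda>k. points (F k)"] ab
    unfolding S_def is_act_def by blast
  define act where "act = (\<lambda>q s. case inv_into S e q of (k, x) \<Rightarrow> e (k, action (F k) x s))"
  define Q :: "('u, 's) act" where "Q = \<lparr>points = e ` S, action = act\<rparr>"
  have act: "act (e (k, x)) s = e (k, action (F k) x s)" if "(k, x) \<in> S" for k x s
    using that e(1) by (simp add: act_def)
  have S: "(k, action (F k) x s) \<in> S" if "(k, x) \<in> S" for k x s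
    using that is_act_action[OF F] by (auto simp: S_def)
  have "is_act small Q"
    unfolding is_act_def
  proof (intro conjI ballI allI)
    show "small (points Q)"
      using e by (simp add: Q_def)
    fix q s t
    assume "q \<in> points Q"
    then obtain k x where q: "(k, x) \<in> S" "q = e (k, x)"
      by (auto simp: Q_def)
    then have x: "x \<in> points (F k)"
      by (auto simp: S_def)
    show "action Q q s \<in> points Q"
      using q S by (simp add: Q_def act)
    show "action Q q 1 = q"
      using q x F[of k] by (simp add: Q_def act is_act_def)
    show "action Q (action Q q s) t = action Q q (s * t)"
      using q x S F[of k] by (simp add: Q_def act is_act_def)
  qed
  moreover have "binary_coproduct A P Q (\<lambda>x. e (a, x)) (\<lambda>x. e (b, x))"
  proof -
    have in_S: "(a, x) \<in> S" if "x \<in> points A" for x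
      using that by (simp add: S_def F_def)
    have in_S': "(b, x) \<in> S" if "x \<in> points P" for x
      using that ab by (simp add: S_def F_def)
    have "(\<lambda>x. e (a, x)) \<in> act_hom A Q"
      using in_S by (intro act_homI) (auto simp: Q_def act F_def)
    moreover have "(\<lambda>x. e (b, x)) \<in> act_hom P Q"
      using in_S' ab by (intro act_homI) (auto simp: Q_def act F_def)
    moreover have "inj_on (\<lambda>x. e (a, x)) (points A)" "inj_on (\<lambda>x. e (b, x)) (points P)"
      using in_S in_S' by (auto simp: inj_on_def dest: inj_onD[OF e(1)])
    moreover have "(\<lambda>x. e (a, x)) ` points A \<inter> (\<lambda>x. e (b, x)) ` points P = {}"
      using in_S in_S' ab by (auto dest: inj_onD[OF e(1)])
    moreover have "points Q = (\<lambda>x. e (a, x)) ` points A \<union> (\<lambda>x. e (b, x)) ` points P"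
      using ab by (auto simp: Q_def S_def F_def)
    ultimately show ?thesis
      by (simp add: binary_coproduct_def)
  qed
  ultimately show thesis
    using that by blast
qed


section \<open>Unitary monomorphisms\<close>

lemma is_mapD:
  assumes "is_map small f"
  shows "is_act small (Dom f)" "is_act small (Cod f)" "app f \<in> act_hom (Dom f) (Cod f)"
  using assms by (auto simp: is_map_def)

lemma im_subset: "is_map small f \<Longrightarrow> im f \<subseteq> points (Cod f)"
  by (auto simp: im_def is_map_def act_hom_def)

lemma im_action:
  assumes f: "is_map small f" and "y \<in> im f"
  shows "action (Cod f) y s \<in> im f"
proof -
  obtain x where "x \<in> points (Dom f)" "y = app f x"
    using assms by (auto simp: im_def)
  then show ?thesis
    using act_hom_action[OF is_mapD(3)[OF f], symmetric] is_act_action[OF is_mapD(1)[OF f]]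
    by (auto simp: im_def)
qed

text \<open>With this decomposition a map out of \<open>Cod f\<close> can be glued from a map on
  \<open>Dom f\<close> and a map on the complement of the image.\<close>

lemma unitary_mono_coproduct:
  assumes "unitary_mono small f"
  shows "binary_coproduct (Dom f) ((Cod f)\<lparr>points := points (Cod f) - im f\<rparr>) (Cod f)
    (app f) (\<lambda>x. x)"
proof -
  have f: "is_map small f"
    using assms by (simp add: unitary_mono_def)
  show ?thesis
    using assms is_mapD(3)[OF f] im_subset[OF f]
      act_hom_restrict[OF act_hom_id, of "points (Cod f) - im f" "Cod f"]
    by (auto simp: binary_coproduct_def unitary_mono_def im_def)
qed

text \<open>On the image of \<open>f\<close> the lift is forced to be \<open>u\<close>; on the
  complement \<open>Z\<close> projectivity with respect to \<open>g\<close> lifts the restriction of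
  \<open>v\<close>. The two pieces are copaired.\<close>

lemma unitary_class_lifting:
  assumes \<X>: "\<forall>A\<in>\<X>. is_act small A"
    and f: "f \<in> unitary_class small \<X>" and g: "g \<in> projecting_class small \<X>"
  shows "has_lifting f g"
  unfolding has_lifting_def
proof (intro ballI impI)
  fix u v
  assume u: "u \<in> act_hom (Dom f) (Dom g)" and v: "v \<in> act_hom (Cod f) (Cod g)"
    and comm: "\<forall>x\<in>points (Dom f). app g (u x) = v (app f x)"
  define Z where "Z = (Cod f)\<lparr>points := points (Cod f) - im f\<rparr>"
  have fu: "unitary_mono small f" and Z: "Z \<in> \<X>"
    using f by (auto simp: unitary_class_def Z_def)
  have Df: "is_act small (Dom f)"
    using fu by (simp add: unitary_mono_def is_map_def)
  have Q: "binary_coproduct (Dom f) Z (Cod f) (app f) (\<lambda>x. x)"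
    using unitary_mono_coproduct[OF fu] by (simp add: Z_def)
  have "v \<in> act_hom Z (Cod g)"
    unfolding Z_def by (rule act_hom_restrict[OF v]) auto
  then obtain w where w: "w \<in> act_hom Z (Dom g)" "\<forall>x\<in>points Z. app g (w x) = v x"
    using g Z unfolding projecting_class_def projective_wrt_def by blast
  obtain h where h: "h \<in> act_hom (Cod f) (Dom g)" "\<And>x. x \<in> points (Dom f) \<Longrightarrow> h (app f x) = u x"
    "\<And>x. x \<in> points Z \<Longrightarrow> h x = w x"
    using binary_coproduct_copair[OF Q Df bspec[OF \<X> Z] u w(1)] by metis
  have "app g (h y) = v y" if "y \<in> points (Cod f)" for y
    using that Q h w comm by (auto simp: binary_coproduct_def)
  with h show "\<exists>h\<in>act_hom (Cod f) (Dom g).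
      (\<forall>x\<in>points (Dom f). h (app f x) = u x) \<and> (\<forall>y\<in>points (Cod f). app g (h y) = v y)"
    by blast
qed

section \<open>The inclusion of the empty act\<close>

definition empty_inclusion :: "('u, 's) act \<Rightarrow> ('u, 's) act_map" where
  "empty_inclusion A = \<lparr>Dom = A\<lparr>points := {}\<rparr>, Cod = A, app = (\<lambda>x. x)\<rparr>"

lemma empty_inclusion_simps [simp]:
  "points (Dom (empty_inclusion A)) = {}" "Cod (empty_inclusion A) = A" "im (empty_inclusion A) = {}"
  by (auto simp: empty_inclusion_def im_def)

lemma (in set_universe) is_map_empty_inclusion:
  assumes "is_act small A"
  shows "is_map small (empty_inclusion A)"
  using is_act_restrict[OF assms, of "{}"] assms
  by (auto simp: is_map_def empty_inclusion_def act_hom_def)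

text \<open>The complement of the empty image is \<open>P\<close> itself, and unitarity is
  vacuous.\<close>

lemma (in set_universe) empty_inclusion_unitary_class:
  assumes "\<forall>A\<in>\<X>. is_act small A" "P \<in> \<X>"
  shows "empty_inclusion P \<in> unitary_class small \<X>"
  using is_map_empty_inclusion assms by (auto simp: unitary_class_def unitary_mono_def)

text \<open>One inclusion is \<open>unitary_class_lifting\<close>. For the other, \<open>g\<close>
  is tested on \<open>empty_inclusion P\<close>: a square from it to \<open>g\<close> is just a map
  from \<open>P\<close> to \<open>Cod g\<close>, and a diagonal is a lift of that map along
  \<open>g\<close>.\<close>

lemma (in set_universe) projecting_class_eq_right_box:
  assumes \<X>: "\<forall>A\<in>\<X>. is_act small A"
  shows "projecting_class small \<X> = right_box small (unitary_class small \<X>)"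
proof
  show "projecting_class small \<X> \<subseteq> right_box small (unitary_class small \<X>)"
    using unitary_class_lifting[OF \<X>] by (auto simp: right_box_def projecting_class_def)
next
  have "projective_wrt P g"
    if g: "g \<in> right_box small (unitary_class small \<X>)" and P: "P \<in> \<X>" for g P
  proof -
    have "has_lifting (empty_inclusion P) g"
      using g empty_inclusion_unitary_class[OF \<X> P] by (auto simp: right_box_def)
    \<comment> \<open>The empty act is initial, so any function serves as the top of the
      square.\<close>
    moreover have "u \<in> act_hom (Dom (empty_inclusion P)) (Dom g)" for u
      by (rule act_homI) auto
    ultimately show ?thesis
      by (auto simp: has_lifting_def projective_wrt_def)
  qed
  then show "right_box small (unitary_class small \<X>) \<subseteq> projecting_class small \<X>"
    by (auto simp: projecting_class_def right_box_def)
qed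


section \<open>Factorizations and precovers\<close>

text \<open>The middle object is the coproduct of \<open>Dom f\<close> and \<open>Dom p\<close>,
  with \<open>g\<close> the copairing of \<open>f\<close> and \<open>p\<close>. The conclusion also
  exposes \<open>j\<close>, because the retract argument has to recognise the points that come from
  the precover.\<close>

lemma (in set_universe) factorization_of_precover:
  assumes \<X>: "\<forall>A\<in>\<X>. is_act small A" and retr: "closed_under_retracts small \<X>"
    and f: "is_map small f" and p: "is_precover small \<X> (Cod f) p"
  obtains i g j where "i \<in> unitary_class small \<X>" "g \<in> projecting_class small \<X>" "factors_as f g i"
    "binary_coproduct (Dom f) (Dom p) (Cod i) (app i) j"
    "\<And>x. x \<in> points (Dom p) \<Longrightarrow> app g (j x) = app p x"
proof -
  define P where "P = Dom p"
  have P: "P \<in> \<X>" "is_act small P" and pm: "app p \<in> act_hom P (Cod f)"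
    using p \<X> by (auto simp: is_precover_def P_def is_map_def)
  note fD = is_mapD[OF f]
  obtain Q i j where Qa: "is_act small Q" and Q: "binary_coproduct (Dom f) P Q i j"
    using binary_coproduct_exists[OF fD(1) P(2)] .
  obtain g where g: "g \<in> act_hom Q (Cod f)" "\<And>x. x \<in> points (Dom f) \<Longrightarrow> g (i x) = app f x"
    "\<And>x. x \<in> points P \<Longrightarrow> g (j x) = app p x"
    using binary_coproduct_copair[OF Q fD(1) P(2) fD(3) pm] by metis
  define I where "I = \<lparr>Dom = Dom f, Cod = Q, app = i\<rparr>"
  define G where "G = \<lparr>Dom = Q, Cod = Cod f, app = g\<rparr>"
  have j: "j \<in> act_hom P Q"
    using Q by (simp add: binary_coproduct_def)
  have imI: "im I = i ` points (Dom f)"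
    by (simp add: I_def im_def)
  then have compl: "points Q - im I = j ` points P"
    using Q by (auto simp: binary_coproduct_def)
  have jact: "action Q y s \<in> j ` points P" if "y \<in> j ` points P" for y s
    using that act_hom_action[OF j, symmetric] is_act_action[OF P(2)] by auto
  have mapI: "is_map small I"
    using fD Qa Q by (auto simp: is_map_def I_def binary_coproduct_def)
  have "unitary_mono small I"
    unfolding unitary_mono_def
  proof (intro conjI ballI allI impI)
    show "inj_on (app I) (points (Dom I))"
      using Q by (simp add: I_def binary_coproduct_def)
    fix y s
    assume "y \<in> points (Cod I)" "action (Cod I) y s \<in> im I"
    \<comment> \<open>Otherwise \<open>y\<close> lies in the copy of \<open>P\<close>, which the
      action does not leave.\<close>
    then show "y \<in> im I"
      using jact[of y s] compl by (auto simp: I_def)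
  qed (rule mapI)
  \<comment> \<open>The complement of \<open>im I\<close> is only a copy of \<open>P\<close>;
    membership in \<open>\<X>\<close> passes along the isomorphism \<open>j\<close>.\<close>
  moreover have "Q\<lparr>points := j ` points P\<rparr> \<in> \<X>"
  proof (rule closed_under_retracts_iso[OF retr P(1) _ _ _ P(2)])
    show "is_act small (Q\<lparr>points := j ` points P\<rparr>)"
      using j jact by (intro is_act_restrict[OF Qa]) (auto simp: act_hom_def)
    show "j \<in> act_hom P (Q\<lparr>points := j ` points P\<rparr>)"
      using act_hom_action[OF j] by (intro act_homI) auto
    show "bij_betw j (points P) (points (Q\<lparr>points := j ` points P\<rparr>))"
      using Q by (simp add: bij_betw_def binary_coproduct_def)
  qed
  ultimately have I: "I \<in> unitary_class small \<X>"
    using compl by (simp add: unitary_class_def I_def)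
  \<comment> \<open>A map from \<open>P'\<close> to \<open>Cod f\<close> factors through the
    precover \<open>p\<close>, and \<open>j\<close> carries the factor into
    \<open>Q\<close>.\<close>
  have "projective_wrt P' G" if P': "P' \<in> \<X>" for P'
    unfolding projective_wrt_def
  proof
    fix g'
    assume "g' \<in> act_hom P' (Cod G)"
    then obtain k where k: "k \<in> act_hom P' P" "\<forall>x\<in>points P'. g' x = app p (k x)"
      using p P' unfolding is_precover_def P_def G_def by simp blast
    have "(\<lambda>x. j (k x)) \<in> act_hom P' (Dom G)"
      using act_hom_comp[OF k(1) j] by (simp add: G_def)
    moreover have "\<forall>x\<in>points P'. app G (j (k x)) = g' x"
      using k g(3) act_hom_in[OF k(1)] by (simp add: G_def)
    ultimately show "\<exists>h\<in>act_hom P' (Dom G). \<forall>x\<in>points P'. app G (h x) = g' x"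
      by (intro bexI[of _ "\<lambda>x. j (k x)"])
  qed
  then have "G \<in> projecting_class small \<X>"
    using Qa fD g(1) by (auto simp: projecting_class_def is_map_def G_def)
  moreover have "factors_as f G I"
    using g(2) by (simp add: factors_as_def I_def G_def)
  moreover have "binary_coproduct (Dom f) (Dom p) (Cod I) (app I) j"
    using Q by (simp add: I_def P_def)
  moreover have "\<And>x. x \<in> points (Dom p) \<Longrightarrow> app G (j x) = app p x"
    using g(3) by (simp add: G_def P_def)
  ultimately show thesis
    using that I by blast
qed

section \<open>Left lifting maps are unitary with complement in the class\<close>

lemma (in set_universe) direct_summand_vimage:
  assumes P: "is_act small P" and p: "p \<in> act_hom P B"
    and C: "\<And>y s. y \<in> points B \<Longrightarrow> action B y s \<in> C \<longleftrightarrow> y \<in> C"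
  shows "direct_summand small (P\<lparr>points := {x \<in> points P. p x \<in> C}\<rparr>) P"
proof -
  \<comment> \<open>Stability of \<open>D\<close> under the action makes its preimage a subact. The
    equivalence in \<open>C\<close> makes both \<open>C\<close> and its complement stable within
    \<open>B\<close>, so the two preimages split \<open>P\<close>.\<close>
  have sub: "subact small (P\<lparr>points := {x \<in> points P. p x \<in> D}\<rparr>) P"
    if D: "\<And>y s. y \<in> points B \<Longrightarrow> y \<in> D \<Longrightarrow> action B y s \<in> D" for D
  proof -
    have "is_act small (P\<lparr>points := {x \<in> points P. p x \<in> D}\<rparr>)"
      using D is_act_action[OF P] act_hom_action[OF p] act_hom_in[OF p]
      by (intro is_act_restrict[OF P]) auto
    then show ?thesis
      by (auto simp: subact_def)
  qed
  have "subact small (P\<lparr>points := {x \<in> points P. p x \<in> - C}\<rparr>) P"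
    using C by (intro sub) auto
  then show ?thesis
    unfolding direct_summand_def
    using C by (intro conjI sub exI[of _ "P\<lparr>points := {x \<in> points P. p x \<in> - C}\<rparr>"]) auto
qed

text \<open>A variant of the retract argument: lifting \<open>f\<close> against the second factor
  \<open>g\<close> of its factorization gives a section \<open>h\<close> of \<open>g\<close> with
  \<open>h f = i\<close>. Injectivity and unitarity pull back from \<open>i\<close> along
  \<open>h\<close>, and on the complement of \<open>im f\<close> the section runs through the copy
  of the precover.\<close>

lemma (in set_universe) left_box_subset_unitary_class:
  assumes \<X>: "\<forall>A\<in>\<X>. is_act small A"
    and summ: "closed_under_direct_summands small \<X>" and retr: "closed_under_retracts small \<X>"
    and f: "f \<in> left_box small (projecting_class small \<X>)"
    and p: "is_precover small \<X> (Cod f) p"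
  shows "f \<in> unitary_class small \<X>"
proof -
  have fm: "is_map small f"
    using f by (simp add: left_box_def)
  note fD = is_mapD[OF fm]
  obtain i g j where i: "i \<in> unitary_class small \<X>" and g: "g \<in> projecting_class small \<X>"
    and fac: "factors_as f g i"
    and Q: "binary_coproduct (Dom f) (Dom p) (Cod i) (app i) j"
    and gj: "\<And>x. x \<in> points (Dom p) \<Longrightarrow> app g (j x) = app p x"
    using factorization_of_precover[OF \<X> retr fm p] by blast
  have eqs: "Dom i = Dom f" "Cod i = Dom g" "Cod g = Cod f"
    and gi: "\<And>x. x \<in> points (Dom f) \<Longrightarrow> app g (app i x) = app f x"
    using fac by (auto simp: factors_as_def)
  have iu: "unitary_mono small i"
    using i by (simp add: unitary_class_def)
  have "app i \<in> act_hom (Dom f) (Dom g)"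
    using Q eqs by (simp add: binary_coproduct_def)
  \<comment> \<open>The square has \<open>i\<close> on top and the identity at the bottom; it
    commutes because \<open>f = g i\<close>.\<close>
  moreover have "(\<lambda>x. x) \<in> act_hom (Cod f) (Cod g)"
    by (simp add: eqs act_hom_id)
  moreover have "has_lifting f g"
    using f g by (simp add: left_box_def)
  ultimately obtain h where h: "h \<in> act_hom (Cod f) (Dom g)"
    and hf: "\<And>x. x \<in> points (Dom f) \<Longrightarrow> h (app f x) = app i x"
    and gh: "\<And>y. y \<in> points (Cod f) \<Longrightarrow> app g (h y) = y"
    using gi unfolding has_lifting_def by metis
  \<comment> \<open>If \<open>h y = i x\<close>, applying \<open>g\<close> gives
    \<open>y = f x\<close>; the converse is \<open>h f = i\<close>.\<close>
  have im_iff: "h y \<in> im i \<longleftrightarrow> y \<in> im f" if "y \<in> points (Cod f)" for y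
    using that gh gi hf eqs by (fastforce simp: im_def)
  have im_act: "action (Cod f) y s \<in> im f \<longleftrightarrow> y \<in> im f" if y: "y \<in> points (Cod f)" for y s
  proof
    assume "action (Cod f) y s \<in> im f"
    then have "action (Cod i) (h y) s \<in> im i"
      using im_iff[OF is_act_action[OF fD(2) y]] act_hom_action[OF h y] eqs by simp
    then show "y \<in> im f"
      using iu act_hom_in[OF h y] im_iff[OF y] eqs by (auto simp: unitary_mono_def)
  qed (rule im_action[OF fm])
  have "inj_on (app f) (points (Dom f))"
    using Q hf unfolding binary_coproduct_def inj_on_def by metis
  then have "unitary_mono small f"
    using fm im_act by (auto simp: unitary_mono_def)
  moreover have "(Cod f)\<lparr>points := points (Cod f) - im f\<rparr> \<in> \<X>" (is "?Z \<in> \<X>")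
  proof -
    \<comment> \<open>\<open>D\<close> is the preimage of \<open>C\<close> under the precover. Since
      \<open>C\<close> and \<open>im f\<close> are both stable under the action, \<open>D\<close> is
      a direct summand of \<open>P\<close>, and \<open>C\<close> will be a retract of it.\<close>
    define C where "C = points (Cod f) - im f"
    define P where "P = Dom p"
    define D where "D = P\<lparr>points := {x \<in> points P. app p x \<in> C}\<rparr>"
    have P: "P \<in> \<X>" and pm: "app p \<in> act_hom P (Cod f)"
      using p by (auto simp: is_precover_def P_def is_map_def)
    note Pa = bspec[OF \<X> P]
    have Cact: "action (Cod f) y s \<in> C \<longleftrightarrow> y \<in> C" if "y \<in> points (Cod f)" for y s
      using im_act[OF that] that is_act_action[OF fD(2) that] by (simp add: C_def)
    have "direct_summand small D P"
      unfolding D_def using direct_summand_vimage[OF Pa pm Cact] .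
    then have D: "D \<in> \<X>"
      using summ P by (auto simp: closed_under_direct_summands_def)
    have j: "j \<in> act_hom P (Dom g)" and jinj: "inj_on j (points P)"
      using Q eqs by (auto simp: binary_coproduct_def P_def)
    \<comment> \<open>By \<open>im_iff\<close>, \<open>h\<close> maps \<open>C\<close> outside
      \<open>im i\<close>, hence into the copy of \<open>P\<close>; undoing \<open>j\<close> there
      yields a section of \<open>p\<close> over \<open>C\<close>.\<close>
    define k where "k = (\<lambda>y. inv_into (points P) j (h y))"
    have k: "k y \<in> points P" "j (k y) = h y" if "y \<in> C" for y
    proof -
      have "h y \<in> points (Dom g)" "h y \<notin> im i"
        using that act_hom_in[OF h] im_iff by (auto simp: C_def)
      then have "h y \<in> j ` points P"
        using Q eqs by (auto simp: binary_coproduct_def im_def P_def)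
      then show "k y \<in> points P" "j (k y) = h y"
        by (auto simp: k_def inv_into_into f_inv_into_f)
    qed
    have pk: "app p (k y) = y" if "y \<in> C" for y
      using gj[of "k y"] k[OF that] gh[of y] that by (simp add: P_def C_def)
    have "k \<in> act_hom ?Z D"
    proof (rule act_homI)
      show "k y \<in> points D" if "y \<in> points ?Z" for y
        using that k pk by (simp add: D_def C_def)
      show "k (action ?Z y s) = action D (k y) s" if "y \<in> points ?Z" for y s
      proof -
        have y: "y \<in> C" "y \<in> points (Cod f)"
          using that by (auto simp: C_def)
        have ys: "action (Cod f) y s \<in> C"
          using y Cact by simp
        \<comment> \<open>Equivariance of \<open>k\<close> is checked after applying the injective
          map \<open>j\<close>, where it becomes equivariance of \<open>h\<close>.\<close>
        have "j (k (action (Cod f) y s)) = j (action P (k y) s)"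
          using k[OF y(1)] k(2)[OF ys] act_hom_action[OF h y(2)] act_hom_action[OF j] by simp
        then have "k (action (Cod f) y s) = action P (k y) s"
          using inj_onD[OF jinj] k(1)[OF ys] is_act_action[OF Pa] k(1)[OF y(1)] by blast
        then show ?thesis
          by (simp add: D_def)
      qed
    qed
    moreover have "app p \<in> act_hom D ?Z"
      using act_hom_action[OF pm] by (intro act_homI) (auto simp: D_def C_def)
    moreover have "\<forall>y\<in>points ?Z. app p (k y) = y"
      using pk by (simp add: C_def)
    ultimately have "retract_of ?Z D"
      unfolding retract_of_def by blast
    moreover have "is_act small ?Z"
      using Cact by (intro is_act_restrict[OF fD(2)]) (auto simp: C_def)
    ultimately show ?thesis
      using retr D unfolding closed_under_retracts_def by blast
  qed
  ultimately show ?thesis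
    by (simp add: unitary_class_def)
qed

section \<open>The two directions of the equivalence\<close>

lemma (in set_universe) weak_factorization_system_of_precovers:
  fixes \<X> :: "('u, 's::monoid_mult) act set"
  assumes \<X>: "\<forall>A\<in>\<X>. is_act small A"
    and "closed_under_direct_summands small \<X>" and retr: "closed_under_retracts small \<X>"
    and pre: "\<And>A. is_act small A \<Longrightarrow> \<exists>g. is_precover small \<X> A g"
  shows "weak_factorization_system small (unitary_class small \<X>) (projecting_class small \<X>)"
  unfolding weak_factorization_system_def
proof (intro conjI allI impI)
  show "projecting_class small \<X> = right_box small (unitary_class small \<X>)"
    using projecting_class_eq_right_box[OF \<X>] .
  show "unitary_class small \<X> = left_box small (projecting_class small \<X>)"
  proof
    show "unitary_class small \<X> \<subseteq> left_box small (projecting_class small \<X>)"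
      using unitary_class_lifting[OF \<X>]
      by (auto simp: left_box_def unitary_class_def unitary_mono_def)
    show "left_box small (projecting_class small \<X>) \<subseteq> unitary_class small \<X>"
    proof
      fix f
      assume f: "f \<in> left_box small (projecting_class small \<X>)"
      then have "is_act small (Cod f)"
        by (simp add: left_box_def is_map_def)
      with f show "f \<in> unitary_class small \<X>"
        using left_box_subset_unitary_class assms by blast
    qed
  qed
  fix h :: "('u, 's) act_map"
  assume h: "is_map small h"
  \<comment> \<open>Precovers enter twice: for the codomain of a left lifting map above, and here
    for the codomain of the map to be factored.\<close>
  obtain p where "is_precover small \<X> (Cod h) p"
    using pre is_mapD(2)[OF h] by blast
  then show "\<exists>f\<in>unitary_class small \<X>. \<exists>g\<in>projecting_class small \<X>. factors_as h g f"
    using factorization_of_precover[OF \<X> retr h] by metis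
qed

text \<open>Factor the inclusion of the empty act into \<open>A\<close>. The left factor has empty
  image, so its whole codomain \<open>Dom g\<close> is the complement and lies in
  \<open>\<X>\<close>; the right factor \<open>g\<close> lifts every map from \<open>\<X>\<close> to
  \<open>A\<close>, so it is a precover.\<close>

lemma (in set_universe) precover_of_weak_factorization_system:
  assumes "weak_factorization_system small (unitary_class small \<X>) (projecting_class small \<X>)"
    and A: "is_act small A"
  shows "\<exists>g. is_precover small \<X> A g"
proof -
  obtain f g where f: "f \<in> unitary_class small \<X>" and g: "g \<in> projecting_class small \<X>"
    and fac: "factors_as (empty_inclusion A) g f"
    using assms(1) is_map_empty_inclusion[OF A] unfolding weak_factorization_system_def by blast
  have "im f = {}"
    using fac by (simp add: factors_as_def im_def)
  then have "Dom g \<in> \<X>"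
    using f fac by (simp add: unitary_class_def factors_as_def)
  then have "is_precover small \<X> A g"
    using g fac
    unfolding is_precover_def projecting_class_def projective_wrt_def factors_as_def
    by simp metis
  then show ?thesis ..
qed

theorem theorem3p5:
  fixes small :: "'u set \<Rightarrow> bool"
    and \<X> :: "('u, 's::monoid_mult) act set"
  assumes "set_universe small"
    and "\<forall>A\<in>\<X>. is_act small A"
    and "closed_under_coproducts small \<X>"
    and "closed_under_direct_summands small \<X>"
    and "closed_under_retracts small \<X>"
  shows "(\<forall>A. is_act small A \<longrightarrow> (\<exists>g. is_precover small \<X> A g)) \<longleftrightarrow>
    weak_factorization_system small (unitary_class small \<X>) (projecting_class small \<X>) \<and>
    (\<forall>X. is_act small X \<longrightarrow> (\<exists>Y\<in>\<X>. act_hom Y X \<noteq> {}))"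
proof -
  interpret set_universe small
    by fact
  show ?thesis
  proof (intro iffI conjI allI impI)
    assume pre: "\<forall>A. is_act small A \<longrightarrow> (\<exists>g. is_precover small \<X> A g)"
    then show "weak_factorization_system small (unitary_class small \<X>) (projecting_class small \<X>)"
      using weak_factorization_system_of_precovers assms(2,4,5) by blast
    fix X :: "('u, 's) act"
    assume "is_act small X"
    then obtain p where "is_precover small \<X> X p"
      using pre by blast
    \<comment> \<open>The precover is itself a map to \<open>X\<close> from an act in
      \<open>\<X>\<close>.\<close>
    then show "\<exists>Y\<in>\<X>. act_hom Y X \<noteq> {}"
      by (auto simp: is_precover_def is_map_def)
  next
    fix A :: "('u, 's) act"
    assume "weak_factorization_system small (unitary_class small \<X>) (projecting_class small \<X>) \<and>
        (\<forall>X. is_act small X \<longrightarrow> (\<exists>Y\<in>\<X>. act_hom Y X \<noteq> {}))"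
      and "is_act small A"
    then show "\<exists>g. is_precover small \<X> A g"
      using precover_of_weak_factorization_system by blast
  qed
qed

end
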